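(* Let $\varphi\in\operatorname{LFM}(B_N)$ be hyperbolic and suppose that $(\varphi,B_N)$ is conjugated to $(\psi,\mathbb{H}^N)$ with $$\psi(z,u,v,w)=\left(\lambda z+2i\langle w,a\rangle+b,\;\sqrt{\lambda}\,u,\;\sqrt{\lambda}\,Dv,\;\sqrt{\lambda}\,Aw\right),$$ where $\lambda>1$, $D$ is a diagonal matrix with $\sigma(D)\subset\partial\mathbb{D}\setminus\{1\}$, and $A=\operatorname{diag}(\lambda_1,\dots,\lambda_r)$ with $0<|\lambda_j|<1$ for $j=1,\dots,r$. Let $\lambda_j=\exp(-u_j+iv_j)$ with $u_j>0$, $v_j\in[0,2\pi)$, and $$\Theta=\operatorname{diag}\left(\frac{\lambda-1}{2u_1\ln\lambda}\frac{\left(\frac{\ln\lambda}{2}+u_1\right)^2+v_1^2}{|\lambda-\sqrt{\lambda}\lambda_1|^2},\dots,\frac{\lambda-1}{2u_r\ln\lambda}\frac{\left(\frac{\ln\lambda}{2}+u_r\right)^2+v_r^2}{|\lambda-\sqrt{\lambda}\lambda_r|^2}\right).$$ If $$\operatorname{Im}b\ge\langle\Theta a,a\rangle,$$ then $\varphi$ can be embedded into a semigroup of $B_N$.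
   Context: $B_N$ is the open unit ball of $\mathbb{C}^N$, $\mathbb{D}$ the open unit disc of $\mathbb{C}$, and $\mathbb{H}^N=\{(u_1,u')\in\mathbb{C}\times\mathbb{C}^{N-1}:\operatorname{Im}u_1>|u'|^2\}$ the Siegel half-plane, biholomorphic to $B_N$. $\langle x,y\rangle=y^Hx$, $^H$ is the conjugate transpose, $\sigma(\cdot)$ is the spectrum. In the formula for $\psi$, $(z,u,v,w)\in\mathbb{H}^N\subset\mathbb{C}\times\mathbb{C}^p\times\mathbb{C}^q\times\mathbb{C}^r$ with $1+p+q+r=N$, $b\in\mathbb{C}$, $a\in\mathbb{C}^r$, $D\in\mathbb{C}^{q\times q}$; some of the blocks $u,v,w$ may be absent. A holomorphic map is linear fractional if it has the form $z\mapsto \frac{Az+B}{\langle z,C\rangle+D}$ with $A\in\mathbb{C}^{N\times N}$, $B,C\in\mathbb{C}^N$, $D\in\mathbb{C}$; $\operatorname{LFM}(B_N)$ is the set of linear fractional self-maps of $B_N$. If a holomorphic self-map $\varphi$ of $B_N$ has no fixed point in $B_N$, its iterates converge locally uniformly to a unique point $w\in\partial B_N$ (the Denjoy-Wolff point), and $\liminf_{z\to w}\frac{1-|\varphi(z)|^2}{1-|z|^2}=\delta\in(0,1]$ is its boundary dilation coefficient; $\varphi$ is hyperbolic if it has no fixed point in $B_N$ and $\delta\in(0,1)$. For holomorphic self-maps $\psi:D\to D$ and $\psi':D'\to D'$ of domains in $\mathbb{C}^N$, $(\psi,D)$ and $(\psi',D')$ are conjugated if there is a biholomorphic map $\sigma:D\to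 D'$ with $\psi=\sigma^{-1}\circ\psi'\circ\sigma$. A (continuous) semigroup $\{\varphi_t\}_{t\ge0}$ on a domain $D$ is a continuous homomorphism from the additive semigroup of non-negative reals into the composition semigroup of holomorphic self-maps of $D$ with the compact-open topology (so $\varphi_0=\mathrm{id}$, $\varphi_{t+s}=\varphi_t\circ\varphi_s$). A self-map $\varphi$ of $D$ can be embedded into a semigroup on $D$ if there is a semigroup $\{\varphi_t\}$ on $D$ with $\varphi_1=\varphi$. *)

theory Defs
  imports "HOL-Analysis.Analysis" "Jordan_Normal_Form.Spectral_Radius"
begin

text \<open>
  Points of complex \<open>N\<close>-space have type \<open>complex ^ 'n\<close> with \<open>N = CARD('n)\<close>, so that \<open>ball 0 1\<close> is
  the unit ball \<open>B_N\<close>.  The blocks of sizes \<open>p\<close>, \<open>q\<close>, \<open>r\<close> may be empty, hence they are vectors and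
  matrices of Jordan_Normal_Form, which allows dimension 0.
\<close>

no_notation Matrix.vec_index (infixl "$" 100)

definition cinner :: "complex ^ 'n \<Rightarrow> complex ^ 'n \<Rightarrow> complex" where
  "cinner x y = (\<Sum>i\<in>UNIV. x $ i * cnj (y $ i))"

text \<open>Holomorphy on an open set: the Frechet derivative exists at every point and is complex
  linear.\<close>

definition holo_on :: "(complex ^ 'n \<Rightarrow> complex ^ 'm) \<Rightarrow> (complex ^ 'n) set \<Rightarrow> bool" where
  "holo_on f D \<longleftrightarrow>
     (\<forall>x\<in>D. \<exists>f'. (f has_derivative f') (at x) \<and> (\<forall>c v. f' (c *s v) = c *s f' v))"

definition holo_self_maps :: "(complex ^ 'n) set \<Rightarrow> (complex ^ 'n \<Rightarrow> complex ^ 'n) set" where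
  "holo_self_maps D = {f. holo_on f D \<and> f ` D \<subseteq> D}"

definition linear_fractional_on ::
    "(complex ^ 'n \<Rightarrow> complex ^ 'n) \<Rightarrow> (complex ^ 'n) set \<Rightarrow> bool" where
  "linear_fractional_on f D \<longleftrightarrow>
     (\<exists>(A :: complex ^ 'n ^ 'n) B C d. \<forall>z\<in>D.
        cinner z C + d \<noteq> 0 \<and> f z = inverse (cinner z C + d) *s (A *v z + B))"

definition LFM :: "(complex ^ 'n \<Rightarrow> complex ^ 'n) set" where
  "LFM = {f \<in> holo_self_maps (ball 0 1). linear_fractional_on f (ball 0 1)}"

definition denjoy_wolff_point ::
    "(complex ^ 'n \<Rightarrow> complex ^ 'n) \<Rightarrow> complex ^ 'n \<Rightarrow> bool" where
  "denjoy_wolff_point f w \<longleftrightarrow> w \<in> sphere 0 1 \<and>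
     (\<forall>z\<in>ball 0 1. \<exists>\<epsilon>>0. ball z \<epsilon> \<subseteq> ball 0 1 \<and>
        uniform_limit (ball z \<epsilon>) (\<lambda>n. f ^^ n) (\<lambda>_. w) sequentially)"

definition dilation_coeff :: "(complex ^ 'n \<Rightarrow> complex ^ 'n) \<Rightarrow> complex ^ 'n \<Rightarrow> ereal" where
  "dilation_coeff f w =
     Liminf (at w within ball 0 1) (\<lambda>z. ereal ((1 - (norm (f z))\<^sup>2) / (1 - (norm z)\<^sup>2)))"

definition hyperbolic :: "(complex ^ 'n \<Rightarrow> complex ^ 'n) \<Rightarrow> bool" where
  "hyperbolic f \<longleftrightarrow> f \<in> holo_self_maps (ball 0 1) \<and> (\<forall>z\<in>ball 0 1. f z \<noteq> z) \<and>
     (\<exists>w. denjoy_wolff_point f w \<and> 0 < dilation_coeff f w \<and> dilation_coeff f w < 1)"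

definition biholomorphic ::
    "(complex ^ 'n \<Rightarrow> complex ^ 'n) \<Rightarrow> (complex ^ 'n) set \<Rightarrow> (complex ^ 'n) set \<Rightarrow> bool" where
  "biholomorphic g D D' \<longleftrightarrow>
     bij_betw g D D' \<and> holo_on g D \<and> holo_on (inv_into D g) D'"

definition conjugated ::
    "(complex ^ 'n \<Rightarrow> complex ^ 'n) \<Rightarrow> (complex ^ 'n) set \<Rightarrow>
     (complex ^ 'n \<Rightarrow> complex ^ 'n) \<Rightarrow> (complex ^ 'n) set \<Rightarrow> bool" where
  "conjugated f D f' D' \<longleftrightarrow> f \<in> holo_self_maps D \<and> f' \<in> holo_self_maps D' \<and>
     (\<exists>g. biholomorphic g D D' \<and> (\<forall>z\<in>D. f z = inv_into D g (f' (g z))))"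

text \<open>Maps are total functions here; two maps that agree on \<open>D\<close> lie in the same open sets of the
  following topology.\<close>

definition compact_open :: "(complex ^ 'n) set \<Rightarrow> (complex ^ 'n \<Rightarrow> complex ^ 'n) topology" where
  "compact_open D = topology_generated_by
     {{f \<in> holo_self_maps D. f ` K \<subseteq> U} | K U. compact K \<and> K \<subseteq> D \<and> open U \<and> U \<subseteq> D}"

definition holo_semigroup ::
    "(real \<Rightarrow> complex ^ 'n \<Rightarrow> complex ^ 'n) \<Rightarrow> (complex ^ 'n) set \<Rightarrow> bool" where
  "holo_semigroup \<Phi> D \<longleftrightarrow>
     (\<forall>t\<ge>0. \<Phi> t \<in> holo_self_maps D) \<and>
     (\<forall>z\<in>D. \<Phi> 0 z = z) \<and>
     (\<forall>s\<ge>0. \<forall>t\<ge>0. \<forall>z\<in>D. \<Phi> (s + t) z = \<Phi> s (\<Phi> t z)) \<and>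
     continuous_map (top_of_set {0..}) (compact_open D) \<Phi>"

definition embeddable :: "(complex ^ 'n \<Rightarrow> complex ^ 'n) \<Rightarrow> (complex ^ 'n) set \<Rightarrow> bool" where
  "embeddable f D \<longleftrightarrow> (\<exists>\<Phi>. holo_semigroup \<Phi> D \<and> (\<forall>z\<in>D. \<Phi> 1 z = f z))"

text \<open>
  In the following, \<open>e\<close> enumerates the coordinates: it is a bijection from \<open>{..<CARD('n)}\<close> onto the
  index type \<open>'n\<close>, and the coordinates of a point \<open>x\<close> in order are
  \<open>x $ e 0, \<dots>, x $ e (CARD('n) - 1)\<close>.
\<close>

definition siegel :: "(nat \<Rightarrow> 'n) \<Rightarrow> (complex ^ 'n) set" where
  "siegel e = {x. Im (x $ e 0) > (\<Sum>k = 1..<CARD('n). (cmod (x $ e k))\<^sup>2)}"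

definition of_coords :: "(nat \<Rightarrow> 'n) \<Rightarrow> complex Matrix.vec \<Rightarrow> complex ^ 'n" where
  "of_coords e y = (\<chi> i. vec_index y (inv_into {..<CARD('n)} e i))"

text \<open>\<open>w \<bullet>c a\<close> is the product of \<open>w\<close> with the conjugate of \<open>a\<close>, i.e. \<open>\<langle>w, a\<rangle> = a\<^sup>H w\<close>.\<close>

definition psi ::
    "(nat \<Rightarrow> 'n) \<Rightarrow> nat \<Rightarrow> nat \<Rightarrow> nat \<Rightarrow> real \<Rightarrow> complex Matrix.vec \<Rightarrow> complex \<Rightarrow>
     complex mat \<Rightarrow> complex mat \<Rightarrow> complex ^ 'n \<Rightarrow> complex ^ 'n" where
  "psi e p q r lam a b D A x =
     (let z = x $ e 0;
          u = Matrix.vec p (\<lambda>j. x $ e (1 + j));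
          v = Matrix.vec q (\<lambda>j. x $ e (1 + p + j));
          w = Matrix.vec r (\<lambda>j. x $ e (1 + p + q + j));
          s = complex_of_real (sqrt lam)
      in of_coords e
           (vCons (complex_of_real lam * z + 2 * \<i> * (w \<bullet>c a) + b)
              ((s \<cdot>\<^sub>v u) @\<^sub>v (s \<cdot>\<^sub>v (D *\<^sub>v v)) @\<^sub>v (s \<cdot>\<^sub>v (A *\<^sub>v w)))))"

definition Theta ::
    "nat \<Rightarrow> real \<Rightarrow> (nat \<Rightarrow> complex) \<Rightarrow> (nat \<Rightarrow> real) \<Rightarrow> (nat \<Rightarrow> real) \<Rightarrow> complex mat" where
  "Theta r lam l u v = mat_diag r (\<lambda>j. complex_of_real
     ((lam - 1) / (2 * u j * ln lam) *
      (((ln lam / 2 + u j)\<^sup>2 + (v j)\<^sup>2) /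
       (cmod (complex_of_real lam - complex_of_real (sqrt lam) * l j))\<^sup>2)))"

end

theory Submission
  imports Defs
begin

text \<open>
  The map \<open>\<psi>\<close> is the time-one map of an affine flow on \<open>\<complex>\<^sup>N\<close> with generator
  \<open>(z, x) \<mapsto> (L z + 2i \<Sum> \<gamma>\<^sub>i x\<^sub>i + \<beta>, \<mu>\<^sub>i x\<^sub>i)\<close>, where \<open>L = ln \<lambda>\<close>.  Along this flow the defining function
  \<open>h = Im z - \<Sum> |x\<^sub>i|\<^sup>2\<close> of the Siegel half-plane satisfies
  \<open>h' = L h + Im \<beta> + \<Sum> (2 Re (\<gamma>\<^sub>i x\<^sub>i) + (L - 2 Re \<mu>\<^sub>i) |x\<^sub>i|\<^sup>2)\<close>.  Completing squares, the terms after \<open>L h\<close>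
  add up to at least \<open>Im \<beta> - \<Sum> |\<gamma>\<^sub>i|\<^sup>2 / (L - 2 Re \<mu>\<^sub>i)\<close>, which is non-negative exactly when
  \<open>Im b \<ge> \<langle>\<Theta> a, a\<rangle>\<close>.  Then \<open>exp (- L t) h\<close> is non-decreasing, so the flow preserves the half-plane, and
  the conjugation carries it over to the ball.
\<close>

section \<open>Semigroups and conjugation\<close>

lemma holo_on_imp_continuous_on: "holo_on f D \<Longrightarrow> continuous_on D f"
  unfolding holo_on_def
  by (metis continuous_at_imp_continuous_on has_derivative_continuous)

lemma holo_on_compose:
  assumes f: "holo_on f D" and g: "holo_on g D'" and sub: "f ` D \<subseteq> D'"
  shows "holo_on (\<lambda>x. g (f x)) D"
  unfolding holo_on_def
proof
  fix x assume x: "x \<in> D"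
  obtain f' where f': "(f has_derivative f') (at x)" "\<And>c v. f' (c *s v) = c *s f' v"
    using f x unfolding holo_on_def by blast
  obtain g' where g': "(g has_derivative g') (at (f x))" "\<And>c v. g' (c *s v) = c *s g' v"
    using g x sub unfolding holo_on_def by blast
  show "\<exists>h'. ((\<lambda>x. g (f x)) has_derivative h') (at x) \<and> (\<forall>c v. h' (c *s v) = c *s h' v)"
    using has_derivative_compose[OF f'(1) g'(1)] f'(2) g'(2)
    by (intro exI[of _ "\<lambda>v. g' (f' v)"]) auto
qed

section \<open>The compact-open topology\<close>

lemma topspace_compact_open: "topspace (compact_open D) = holo_self_maps D"
proof
  show "topspace (compact_open D) \<subseteq> holo_self_maps D"
    unfolding compact_open_def topology_generated_by_topspace by blast
  \<comment> \<open>Taking both \<open>K\<close> and \<open>U\<close> empty makes the whole of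
    \<open>holo_self_maps D\<close> a subbasic set, so the carrier loses no map.\<close>
  have "holo_self_maps D = {f \<in> holo_self_maps D. f ` {} \<subseteq> {}}"
    by simp
  then have "holo_self_maps D \<in> {{f \<in> holo_self_maps D. f ` K \<subseteq> U} | K U.
      compact K \<and> K \<subseteq> D \<and> open U \<and> U \<subseteq> D}"
    using compact_empty open_empty by blast
  then show "holo_self_maps D \<subseteq> topspace (compact_open D)"
    unfolding compact_open_def topology_generated_by_topspace by blast
qed

lemma continuous_map_compact_openI:
  assumes self: "\<And>t. t \<in> T \<Longrightarrow> F t \<in> holo_self_maps D"
    and op: "\<And>K U. compact K \<Longrightarrow> K \<subseteq> D \<Longrightarrow> open U \<Longrightarrow> U \<subseteq> D \<Longrightarrow>
      openin (top_of_set T) {t \<in> T. F t ` K \<subseteq> U}"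
  shows "continuous_map (top_of_set T) (compact_open D) F"
  unfolding compact_open_def
proof (rule continuous_on_generated_topo)
  show "F ` topspace (top_of_set T) \<subseteq> \<Union>{{f \<in> holo_self_maps D. f ` K \<subseteq> U} | K U.
      compact K \<and> K \<subseteq> D \<and> open U \<and> U \<subseteq> D}"
    using self topspace_compact_open[of D]
    unfolding compact_open_def topology_generated_by_topspace by auto
next
  fix V assume "V \<in> {{f \<in> holo_self_maps D. f ` K \<subseteq> U} | K U.
      compact K \<and> K \<subseteq> D \<and> open U \<and> U \<subseteq> D}"
  then obtain K U where V: "V = {f \<in> holo_self_maps D. f ` K \<subseteq> U}"
    and KU: "compact K" "K \<subseteq> D" "open U" "U \<subseteq> D" by blast
  have "F -` V \<inter> topspace (top_of_set T) = {t \<in> T. F t ` K \<subseteq> U}"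
    using self by (auto simp: V)
  then show "openin (top_of_set T) (F -` V \<inter> topspace (top_of_set T))"
    using op[OF KU] by simp
qed

text \<open>Since \<open>F\<close> maps \<open>T\<close> into the carrier, the clause
  \<open>f \<in> holo_self_maps D\<close> of a subbasic set disappears from its preimage. With
  \<open>continuous_map_compact_openI\<close> this reduces continuity to open sets of times, in both
  directions.\<close>

lemma continuous_map_compact_open_openin:
  assumes "continuous_map (top_of_set T) (compact_open D) F"
    and "compact K" "K \<subseteq> D" "open U" "U \<subseteq> D"
  shows "openin (top_of_set T) {t \<in> T. F t ` K \<subseteq> U}"
proof -
  have "openin (compact_open D) {f \<in> holo_self_maps D. f ` K \<subseteq> U}"
    unfolding compact_open_def by (rule topology_generated_by_Basis) (use assms in blast)
  then have "openin (top_of_set T) {t \<in> topspace (top_of_set T). F t \<in> {f \<in> holo_self_maps D. f ` K \<subseteq> U}}"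
    using assms(1) by (rule openin_continuous_map_preimage[rotated])
  moreover have "F t \<in> holo_self_maps D" if "t \<in> T" for t
    using continuous_map_image_subset_topspace[OF assms(1)] that
    by (auto simp: topspace_compact_open)
  then have "{t \<in> topspace (top_of_set T). F t \<in> {f \<in> holo_self_maps D. f ` K \<subseteq> U}}
      = {t \<in> T. F t ` K \<subseteq> U}"
    by auto
  ultimately show ?thesis by simp
qed

text \<open>The times at which some point of \<open>K\<close> is sent outside \<open>U\<close> form
  the projection of a closed subset of \<open>K \<times> T\<close> along the compact factor
  \<open>K\<close>. Such a projection is closed in \<open>T\<close>.\<close>

lemma jointly_continuous_imp_continuous_map_compact_open:
  fixes F :: "'a::euclidean_space \<Rightarrow> complex ^ 'n \<Rightarrow> complex ^ 'n"
  assumes self: "\<And>t. t \<in> T \<Longrightarrow> F t \<in> holo_self_maps D"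
    and cont: "continuous_on (D \<times> T) (\<lambda>(x, t). F t x)"
  shows "continuous_map (top_of_set T) (compact_open D) F"
proof (rule continuous_map_compact_openI[OF self])
  fix K U :: "(complex ^ 'n) set"
  assume K: "compact K" "K \<subseteq> D" and U: "open U"
  let ?C = "(K \<times> T) \<inter> (\<lambda>(x, t). F t x) -` (- U)"
  have "continuous_on (K \<times> T) (\<lambda>(x, t). F t x)"
    using cont by (rule continuous_on_subset) (use K in auto)
  then have "closedin (top_of_set (K \<times> T)) ?C"
    by (rule continuous_closedin_preimage) (use U in auto)
  then have "closedin (top_of_set T) ({t. \<exists>x. x \<in> K \<and> (x, t) \<in> ?C})"
    by (rule closedin_compact_projection[OF K(1)])
  then have "openin (top_of_set T) (T - {t. \<exists>x. x \<in> K \<and> (x, t) \<in> ?C})"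
    by (simp add: openin_diff)
  moreover have "T - {t. \<exists>x. x \<in> K \<and> (x, t) \<in> ?C} = {t \<in> T. F t ` K \<subseteq> U}"
    by auto
  ultimately show "openin (top_of_set T) {t \<in> T. F t ` K \<subseteq> U}"
    by simp
qed

section \<open>Transport of semigroups along a biholomorphic map\<close>

lemma holo_semigroup_conjugate:
  assumes g: "biholomorphic g D D'" and D': "open D'" and \<Psi>: "holo_semigroup \<Psi> D'"
  shows "holo_semigroup (\<lambda>t x. inv_into D g (\<Psi> t (g x))) D"
proof -
  define h where "h = inv_into D g"
  have bij: "bij_betw g D D'" and hg: "holo_on g D" and hh: "holo_on h D'"
    using g unfolding biholomorphic_def h_def by auto
  have gD: "g x \<in> D'" if "x \<in> D" for x
    using bij that by (rule bij_betw_apply)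
  have hD: "h y \<in> D" if "y \<in> D'" for y
    using bij_betw_inv_into[OF bij] that unfolding h_def by (rule bij_betw_apply)
  have hgx: "h (g x) = x" if "x \<in> D" for x
    using bij_betw_inv_into_left[OF bij that] by (simp add: h_def)
  have ghy: "g (h y) = y" if "y \<in> D'" for y
    using bij_betw_inv_into_right[OF bij that] by (simp add: h_def)
  have \<Psi>_self: "\<Psi> t \<in> holo_self_maps D'" if "t \<ge> 0" for t
    using \<Psi> that unfolding holo_semigroup_def by blast
  have \<Psi>D: "\<Psi> t y \<in> D'" if "t \<ge> 0" "y \<in> D'" for t y
    using \<Psi>_self[OF that(1)] that(2) unfolding holo_self_maps_def by blast
  have \<Psi>0: "\<Psi> 0 y = y" if "y \<in> D'" for y
    using \<Psi> that unfolding holo_semigroup_def by blast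
  have \<Psi>_add: "\<Psi> (s + t) y = \<Psi> s (\<Psi> t y)" if "s \<ge> 0" "t \<ge> 0" "y \<in> D'" for s t y
    using \<Psi> that unfolding holo_semigroup_def by blast
  have \<Psi>_cont: "continuous_map (top_of_set {0..}) (compact_open D') \<Psi>"
    using \<Psi> unfolding holo_semigroup_def by blast
  have self: "(\<lambda>x. h (\<Psi> t (g x))) \<in> holo_self_maps D" if t: "t \<ge> 0" for t
  proof -
    have "holo_on (\<lambda>x. \<Psi> t (g x)) D"
      by (rule holo_on_compose[OF hg]) (use \<Psi>_self[OF t] gD in \<open>auto simp: holo_self_maps_def\<close>)
    then have "holo_on (\<lambda>x. h (\<Psi> t (g x))) D"
      by (rule holo_on_compose[OF _ hh]) (use \<Psi>D[OF t] gD in auto)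
    then show ?thesis
      using \<Psi>D[OF t] gD hD by (auto simp: holo_self_maps_def)
  qed
  have cont: "continuous_map (top_of_set {0..}) (compact_open D) (\<lambda>t x. h (\<Psi> t (g x)))"
  proof (rule continuous_map_compact_openI)
    fix K U :: "(complex ^ 'a) set"
    assume K: "compact K" "K \<subseteq> D" and U: "open U" "U \<subseteq> D"
    define V where "V = D' \<inter> h -` U"
    have "compact (g ` K)"
      using holo_on_imp_continuous_on[OF hg] K
      by (meson compact_continuous_image continuous_on_subset)
    moreover have "open V"
      unfolding V_def using holo_on_imp_continuous_on[OF hh] D' U(1)
      by (rule continuous_open_preimage)
    ultimately have "openin (top_of_set {0..}) {t \<in> {0..}. \<Psi> t ` (g ` K) \<subseteq> V}"
      using gD K by (intro continuous_map_compact_open_openin[OF \<Psi>_cont]) (auto simp: V_def)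
    moreover have "{t \<in> {0..}. \<Psi> t ` (g ` K) \<subseteq> V} = {t \<in> {0..}. (\<lambda>x. h (\<Psi> t (g x))) ` K \<subseteq> U}"
      using \<Psi>D gD K(2) unfolding V_def by fastforce
    ultimately show "openin (top_of_set {0..}) {t \<in> {0..}. (\<lambda>x. h (\<Psi> t (g x))) ` K \<subseteq> U}"
      by simp
  qed (use self in auto)
  show ?thesis
    unfolding holo_semigroup_def h_def[symmetric]
    using self cont hgx ghy gD \<Psi>D \<Psi>0 \<Psi>_add by simp
qed

lemma embeddable_if_conjugated:
  assumes "conjugated f D f' D'" and "open D'" and "embeddable f' D'"
  shows "embeddable f D"
proof -
  obtain g where g: "biholomorphic g D D'" "\<forall>z\<in>D. f z = inv_into D g (f' (g z))"
    using assms(1) unfolding conjugated_def by blast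
  obtain \<Psi> where \<Psi>: "holo_semigroup \<Psi> D'" "\<forall>z\<in>D'. \<Psi> 1 z = f' z"
    using assms(3) unfolding embeddable_def by blast
  have "g z \<in> D'" if "z \<in> D" for z
    using g(1) that unfolding biholomorphic_def by (meson bij_betw_apply)
  then show ?thesis
    unfolding embeddable_def using holo_semigroup_conjugate[OF g(1) assms(2) \<Psi>(1)] g(2) \<Psi>(2)
    by (intro exI[of _ "\<lambda>t x. inv_into D g (\<Psi> t (g x))"]) auto
qed

section \<open>Affine flows on the Siegel half-plane\<close>

text \<open>Summing over the index type itself keeps the flow independent of the enumeration
  \<open>e\<close>; the index \<open>o'\<close> plays the role of \<open>e 0\<close>.\<close>

definition siegel_height :: "'n \<Rightarrow> complex ^ 'n \<Rightarrow> real" where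
  "siegel_height o' x = Im (x $ o') - (\<Sum>i\<in>UNIV - {o'}. (cmod (x $ i))\<^sup>2)"

lemma continuous_on_siegel_height: "continuous_on S (siegel_height o')"
  unfolding siegel_height_def by (intro continuous_intros)

lemma sum_except_first_coord:
  fixes e :: "nat \<Rightarrow> 'n::finite"
  assumes "bij_betw e {..<CARD('n)} UNIV"
  shows "(\<Sum>i\<in>UNIV - {e 0}. f i) = (\<Sum>k = 1..<CARD('n). f (e k))"
proof (rule sum.reindex_bij_betw[symmetric])
  have "bij_betw e ({..<CARD('n)} - {0}) (UNIV - {e 0})"
    using assms by (simp add: bij_betw_DiffI)
  moreover have "{..<CARD('n)} - {0} = {1..<CARD('n)}" by auto
  ultimately show "bij_betw e {1..<CARD('n)} (UNIV - {e 0})" by simp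
qed

lemma siegel_eq:
  fixes e :: "nat \<Rightarrow> 'n::finite"
  assumes "bij_betw e {..<CARD('n)} UNIV"
  shows "siegel e = {x. siegel_height (e 0) x > 0}"
  unfolding siegel_def siegel_height_def sum_except_first_coord[OF assms] by simp

lemma open_siegel:
  fixes e :: "nat \<Rightarrow> 'n::finite"
  assumes "bij_betw e {..<CARD('n)} UNIV"
  shows "open (siegel e)"
  unfolding siegel_eq[OF assms]
  by (intro open_Collect_less continuous_on_const continuous_on_siegel_height)

text \<open>The condition \<open>\<mu>_ne\<close> excludes resonance: the first coordinate of the
  flow is then a combination of pure exponentials, without a term
  \<open>t * exp (L * t)\<close>.\<close>

locale affine_flow =
  fixes L :: real and \<mu> \<gamma> :: "'n::finite \<Rightarrow> complex" and \<beta> :: complex and o' :: 'n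
  assumes L_pos: "L > 0"
    and \<mu>_ne: "\<And>i. i \<noteq> o' \<Longrightarrow> complex_of_real L \<noteq> \<mu> i"
begin

text \<open>The solution of \<open>c' = L c + \<gamma>\<^sub>i exp (\<mu>\<^sub>i t)\<close> with
  \<open>c(0) = 0\<close>.\<close>

definition coupling :: "real \<Rightarrow> 'n \<Rightarrow> complex" where
  "coupling t i = \<gamma> i * (exp (of_real (L * t)) - exp (\<mu> i * of_real t)) / (of_real L - \<mu> i)"

text \<open>The solution of \<open>d' = L d + \<beta>\<close> with \<open>d(0) = 0\<close>.\<close>

definition drift :: "real \<Rightarrow> complex" where
  "drift t = \<beta> * (exp (of_real (L * t)) - 1) / of_real L"

text \<open>Kept apart from the translation because it is the derivative of \<open>flow t\<close> at
  every point.\<close>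

definition flow_linear :: "real \<Rightarrow> complex ^ 'n \<Rightarrow> complex ^ 'n" where
  "flow_linear t x = (\<chi> i. if i = o'
     then exp (of_real (L * t)) * x $ o' + 2 * \<i> * (\<Sum>i\<in>UNIV - {o'}. coupling t i * x $ i)
     else exp (\<mu> i * of_real t) * x $ i)"

definition flow :: "real \<Rightarrow> complex ^ 'n \<Rightarrow> complex ^ 'n" where
  "flow t x = flow_linear t x + axis o' (drift t)"

lemma flow_nth_first: "flow t x $ o' = exp (of_real (L * t)) * x $ o'
    + 2 * \<i> * (\<Sum>i\<in>UNIV - {o'}. coupling t i * x $ i) + drift t"
  by (simp add: flow_def flow_linear_def axis_def)

lemma flow_nth_other: "i \<noteq> o' \<Longrightarrow> flow t x $ i = exp (\<mu> i * of_real t) * x $ i"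
  by (simp add: flow_def flow_linear_def axis_def)

lemma flow_0: "flow 0 x = x"
  unfolding Finite_Cartesian_Product.vec_eq_iff
proof
  fix i show "flow 0 x $ i = x $ i"
    by (cases "i = o'") (simp_all add: flow_nth_first flow_nth_other coupling_def drift_def)
qed

text \<open>The mixed terms \<open>exp (L * s) * exp (\<mu> i * t)\<close> of the two summands
  cancel. This cocycle identity and \<open>drift_add\<close> give the semigroup law in the first
  coordinate.\<close>

lemma coupling_add:
  "coupling (s + t) i = exp (of_real (L * s)) * coupling t i + coupling s i * exp (\<mu> i * of_real t)"
  unfolding coupling_def
  by (simp add: exp_add ring_distribs add_divide_distrib diff_divide_distrib ac_simps)

lemma drift_add: "drift (s + t) = exp (of_real (L * s)) * drift t + drift s"
  using L_pos unfolding drift_def by (simp add: field_simps exp_add)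

lemma flow_add: "flow (s + t) x = flow s (flow t x)"
  unfolding Finite_Cartesian_Product.vec_eq_iff
proof
  fix i show "flow (s + t) x $ i = flow s (flow t x) $ i"
  proof (cases "i = o'")
    case True
    have "(\<Sum>i\<in>UNIV - {o'}. coupling (s + t) i * x $ i)
        = exp (of_real (L * s)) * (\<Sum>i\<in>UNIV - {o'}. coupling t i * x $ i)
          + (\<Sum>i\<in>UNIV - {o'}. coupling s i * flow t x $ i)"
      unfolding sum_distrib_left sum.distrib[symmetric]
      by (rule sum.cong) (simp_all add: coupling_add flow_nth_other algebra_simps)
    moreover have "exp (complex_of_real (L * (s + t))) = exp (of_real (L * s)) * exp (of_real (L * t))"
      by (simp add: exp_add distrib_left)
    ultimately show ?thesis
      unfolding True flow_nth_first drift_add by (simp add: algebra_simps)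
  next
    case False
    then show ?thesis
      by (simp add: flow_nth_other exp_add distrib_left)
  qed
qed

lemma flow_linear_scale: "flow_linear t (c *s x) = c *s flow_linear t x"
  by (simp add: Finite_Cartesian_Product.vec_eq_iff flow_linear_def sum_distrib_left algebra_simps)

lemma linear_flow_linear: "linear (flow_linear t)"
proof (rule linearI)
  show "flow_linear t (x + y) = flow_linear t x + flow_linear t y" for x y
    by (simp add: Finite_Cartesian_Product.vec_eq_iff flow_linear_def sum.distrib algebra_simps)
  have "c *\<^sub>R y = complex_of_real c *s y" for c and y :: "complex ^ 'n"
    by (simp add: Finite_Cartesian_Product.vec_eq_iff scaleR_conv_of_real[where 'a = complex])
  then show "flow_linear t (c *\<^sub>R x) = c *\<^sub>R flow_linear t x" for c x
    by (simp add: flow_linear_scale)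
qed

lemma holo_on_flow: "holo_on (flow t) D"
  unfolding holo_on_def
proof
  fix x
  have "(flow_linear t has_derivative flow_linear t) (at x)"
    using linear_flow_linear by (simp add: linear_conv_bounded_linear bounded_linear_imp_has_derivative)
  then have "(flow t has_derivative flow_linear t) (at x)"
    unfolding flow_def by (rule has_derivative_add_const)
  then show "\<exists>f'. (flow t has_derivative f') (at x) \<and> (\<forall>c v. f' (c *s v) = c *s f' v)"
    using flow_linear_scale by blast
qed

lemma continuous_on_flow: "continuous_on S (\<lambda>(x, t). flow t x)"
proof -
  \<comment> \<open>Quotients by constants become products with constant inverses, so that the
    continuity of the products suffices.\<close>
  have *: "flow t x = (\<chi> i. if i = o'
     then exp (of_real (L * t)) * x $ o' + 2 * \<i> * (\<Sum>i\<in>UNIV - {o'}.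
       \<gamma> i * (exp (of_real (L * t)) - exp (\<mu> i * of_real t)) * inverse (of_real L - \<mu> i) * x $ i)
       + \<beta> * (exp (of_real (L * t)) - 1) * inverse (of_real L)
     else exp (\<mu> i * of_real t) * x $ i)" for t x
    unfolding Finite_Cartesian_Product.vec_eq_iff
    by (simp add: flow_nth_first flow_nth_other coupling_def drift_def divide_inverse)
  have "continuous_on S (\<lambda>p. (if i = o'
     then exp (of_real (L * snd p)) * fst p $ o' + 2 * \<i> * (\<Sum>i\<in>UNIV - {o'}.
       \<gamma> i * (exp (of_real (L * snd p)) - exp (\<mu> i * of_real (snd p))) * inverse (of_real L - \<mu> i) * fst p $ i)
       + \<beta> * (exp (of_real (L * snd p)) - 1) * inverse (of_real L)
     else exp (\<mu> i * of_real (snd p)) * fst p $ i))" for i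
    by (cases "i = o'") (simp_all, (intro continuous_intros)+)
  then show ?thesis
    unfolding * case_prod_beta by (intro continuous_on_vec_lambda)
qed

end

text \<open>The last assumption says that \<open>2 Re (\<gamma>\<^sub>i \<zeta>) + (L - 2 Re \<mu>\<^sub>i) |\<zeta>|\<^sup>2 \<ge> - \<kappa>\<^sub>i\<close>; it is stated without
  dividing by \<open>L - 2 Re \<mu>\<^sub>i\<close>, which vanishes for the unitary coordinates.\<close>

locale siegel_flow = affine_flow L \<mu> \<gamma> \<beta> o'
  for L :: real and \<mu> \<gamma> :: "'n::finite \<Rightarrow> complex" and \<beta> :: complex and o' :: 'n +
  fixes \<kappa> :: "'n \<Rightarrow> real"
  assumes \<kappa>_sum: "(\<Sum>i\<in>UNIV - {o'}. \<kappa> i) \<le> Im \<beta>"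
    and \<kappa>_bound: "\<And>i \<zeta>. i \<noteq> o' \<Longrightarrow>
      0 \<le> \<kappa> i + 2 * Re (\<gamma> i * \<zeta>) + (L - 2 * Re (\<mu> i)) * (cmod \<zeta>)\<^sup>2"
begin

section \<open>Differential equations along the flow\<close>

lemma coupling_has_vector_derivative:
  assumes "i \<noteq> o'"
  shows "((\<lambda>t. coupling t i) has_vector_derivative
    of_real L * coupling t i + \<gamma> i * exp (\<mu> i * of_real t)) (at t)"
proof -
  have ne: "of_real L - \<mu> i \<noteq> 0" using \<mu>_ne[OF assms] by simp
  have "((\<lambda>z. \<gamma> i * (exp (of_real L * z) - exp (\<mu> i * z)) / (of_real L - \<mu> i)) has_field_derivative
     \<gamma> i * (of_real L * exp (of_real L * of_real t) - \<mu> i * exp (\<mu> i * of_real t)) / (of_real L - \<mu> i))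
     (at (of_real t))"
    using ne by (auto intro!: derivative_eq_intros)
  then have "((\<lambda>t. coupling t i) has_vector_derivative
     \<gamma> i * (of_real L * exp (of_real L * of_real t) - \<mu> i * exp (\<mu> i * of_real t)) / (of_real L - \<mu> i)) (at t)"
    unfolding coupling_def of_real_mult by (rule has_vector_derivative_real_field)
  moreover have "\<gamma> i * (of_real L * exp (of_real L * of_real t) - \<mu> i * exp (\<mu> i * of_real t)) / (of_real L - \<mu> i)
     = of_real L * coupling t i + \<gamma> i * exp (\<mu> i * of_real t)"
    using ne unfolding coupling_def by (simp add: field_simps)
  ultimately show ?thesis by simp
qed

lemma drift_has_vector_derivative:
  "(drift has_vector_derivative of_real L * drift t + \<beta>) (at t)"
proof -
  have "((\<lambda>z. \<beta> * (exp (of_real L * z) - 1) / of_real L) has_field_derivative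
     \<beta> * exp (of_real L * of_real t)) (at (of_real t))"
    using L_pos by (auto intro!: derivative_eq_intros)
  then have "(drift has_vector_derivative \<beta> * exp (of_real L * of_real t)) (at t)"
    unfolding drift_def of_real_mult by (rule has_vector_derivative_real_field)
  moreover have "\<beta> * exp (of_real L * of_real t) = of_real L * drift t + \<beta>"
    using L_pos unfolding drift_def by (simp add: field_simps)
  ultimately show ?thesis by simp
qed

lemma exp_has_vector_derivative:
  "((\<lambda>t. exp (c * of_real t) * w) has_vector_derivative c * (exp (c * of_real t) * w)) (at t)"
  for c w :: complex
proof -
  have "((\<lambda>z. exp (c * z) * w) has_field_derivative c * (exp (c * of_real t) * w)) (at (of_real t))"
    by (auto intro!: derivative_eq_intros)
  then show ?thesis by (rule has_vector_derivative_real_field)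
qed

lemma flow_first_has_vector_derivative:
  "((\<lambda>t. flow t x $ o') has_vector_derivative
    of_real L * flow t x $ o' + 2 * \<i> * (\<Sum>i\<in>UNIV - {o'}. \<gamma> i * flow t x $ i) + \<beta>) (at t)"
proof -
  have "((\<lambda>t. \<Sum>i\<in>UNIV - {o'}. coupling t i * x $ i) has_vector_derivative
      (\<Sum>i\<in>UNIV - {o'}. (of_real L * coupling t i + \<gamma> i * exp (\<mu> i * of_real t)) * x $ i)) (at t)"
    by (intro has_vector_derivative_sum has_vector_derivative_mult_left coupling_has_vector_derivative) auto
  then have *: "((\<lambda>t. exp (of_real L * of_real t) * x $ o'
        + 2 * \<i> * (\<Sum>i\<in>UNIV - {o'}. coupling t i * x $ i) + drift t) has_vector_derivative
      of_real L * (exp (of_real L * of_real t) * x $ o') + 2 * \<i> *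
      (\<Sum>i\<in>UNIV - {o'}. (of_real L * coupling t i + \<gamma> i * exp (\<mu> i * of_real t)) * x $ i)
      + (of_real L * drift t + \<beta>)) (at t)"
    by (intro has_vector_derivative_add has_vector_derivative_mult_right
        exp_has_vector_derivative drift_has_vector_derivative)
  have sum_eq: "(\<Sum>i\<in>UNIV - {o'}. (of_real L * coupling t i + \<gamma> i * exp (\<mu> i * of_real t)) * x $ i)
      = of_real L * (\<Sum>i\<in>UNIV - {o'}. coupling t i * x $ i) + (\<Sum>i\<in>UNIV - {o'}. \<gamma> i * flow t x $ i)"
    unfolding sum_distrib_left sum.distrib[symmetric]
    by (rule sum.cong) (simp_all add: flow_nth_other algebra_simps)
  show ?thesis
    using * unfolding flow_nth_first of_real_mult sum_eq
    by (rule has_vector_derivative_eq_rhs) (simp add: distrib_left)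
qed

text \<open>The factor \<open>2 * \<i>\<close> turns the imaginary part of the coupling term into
  \<open>2 * Re (\<gamma> i * x $ i)\<close>, and each squared modulus grows at rate
  \<open>2 * Re (\<mu> i)\<close>. Replacing \<open>L * Im (x $ o')\<close> by \<open>L\<close>
  times the height adds \<open>L\<close> times the squared moduli, whence the coefficient
  \<open>L - 2 * Re (\<mu> i)\<close>.\<close>

lemma siegel_height_flow_has_derivative:
  "((\<lambda>t. siegel_height o' (flow t x)) has_real_derivative
     L * siegel_height o' (flow t x) + Im \<beta> +
     (\<Sum>i\<in>UNIV - {o'}. 2 * Re (\<gamma> i * flow t x $ i) + (L - 2 * Re (\<mu> i)) * (cmod (flow t x $ i))\<^sup>2)) (at t)"
proof -
  have cm: "((\<lambda>t. (cmod (flow t x $ i))\<^sup>2) has_real_derivative 2 * Re (\<mu> i) * (cmod (flow t x $ i))\<^sup>2) (at t)"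
    if "i \<noteq> o'" for i
  proof -
    have eq: "(cmod (flow t x $ i))\<^sup>2 = exp (2 * Re (\<mu> i) * t) * (cmod (x $ i))\<^sup>2" for t
      using that by (simp add: flow_nth_other norm_mult power_mult_distrib exp_double[symmetric] mult.assoc)
    show ?thesis
      unfolding eq by (auto intro!: derivative_eq_intros)
  qed
  have im: "((\<lambda>t. Im (flow t x $ o')) has_real_derivative
    Im (of_real L * flow t x $ o' + 2 * \<i> * (\<Sum>i\<in>UNIV - {o'}. \<gamma> i * flow t x $ i) + \<beta>)) (at t)"
    using bounded_linear.has_vector_derivative[OF bounded_linear_Im flow_first_has_vector_derivative]
    by (simp add: has_real_derivative_iff_has_vector_derivative)
  have "((\<lambda>t. siegel_height o' (flow t x)) has_real_derivative
    Im (of_real L * flow t x $ o' + 2 * \<i> * (\<Sum>i\<in>UNIV - {o'}. \<gamma> i * flow t x $ i) + \<beta>)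
      - (\<Sum>i\<in>UNIV - {o'}. 2 * Re (\<mu> i) * (cmod (flow t x $ i))\<^sup>2)) (at t)"
    unfolding siegel_height_def by (intro DERIV_diff im DERIV_sum cm) auto
  then show ?thesis
    by (rule DERIV_cong)
      (simp add: siegel_height_def Re_sum sum.distrib sum_subtractf sum_distrib_left algebra_simps)
qed

lemma siegel_height_flow_pos:
  assumes "siegel_height o' x > 0" and "t \<ge> 0"
  shows "siegel_height o' (flow t x) > 0"
proof -
  \<comment> \<open>The integrating factor absorbs the term
    \<open>L * siegel_height o' (flow s x)\<close> of the derivative; what remains is
    \<open>exp (- (L * s)) * R\<close>.\<close>
  define G where "G s = exp (- (L * s)) * siegel_height o' (flow s x)" for s
  have "\<exists>y. (G has_real_derivative y) (at s) \<and> 0 \<le> y" for s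
  proof -
    define R where "R = Im \<beta> + (\<Sum>i\<in>UNIV - {o'}.
      2 * Re (\<gamma> i * flow s x $ i) + (L - 2 * Re (\<mu> i)) * (cmod (flow s x $ i))\<^sup>2)"
    have "0 \<le> (\<Sum>i\<in>UNIV - {o'}. \<kappa> i +
      (2 * Re (\<gamma> i * flow s x $ i) + (L - 2 * Re (\<mu> i)) * (cmod (flow s x $ i))\<^sup>2))"
      using \<kappa>_bound by (intro sum_nonneg) (auto simp: add.assoc)
    then have R: "0 \<le> R"
      using \<kappa>_sum unfolding R_def by (simp add: sum.distrib)
    have "((\<lambda>s. exp (- (L * s))) has_real_derivative - L * exp (- (L * s))) (at s)"
      by (auto intro!: derivative_eq_intros)
    from DERIV_mult[OF this siegel_height_flow_has_derivative[of x s]]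
    have "(G has_real_derivative exp (- (L * s)) * R) (at s)"
      unfolding G_def R_def by (rule DERIV_cong) (simp add: algebra_simps)
    then show ?thesis using R by (intro exI[of _ "exp (- (L * s)) * R"]) simp
  qed
  then have "G 0 \<le> G t"
    by (intro DERIV_nonneg_imp_nondecreasing[OF assms(2)])
  then have "0 < G t"
    using assms(1) by (simp add: G_def flow_0)
  then show ?thesis
    by (simp add: G_def zero_less_mult_iff)
qed

lemma holo_semigroup_flow: "holo_semigroup flow {x. siegel_height o' x > 0}"
proof -
  have self: "flow t \<in> holo_self_maps {x. siegel_height o' x > 0}" if "t \<ge> 0" for t
    using siegel_height_flow_pos that by (auto simp: holo_self_maps_def holo_on_flow)
  have "continuous_map (top_of_set {0..}) (compact_open {x. siegel_height o' x > 0}) flow"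
    using self continuous_on_flow by (intro jointly_continuous_imp_continuous_map_compact_open) auto
  then show ?thesis
    unfolding holo_semigroup_def using self by (simp add: flow_0 flow_add)
qed

end

section \<open>The map \<open>\<psi>\<close> as a time-one map\<close>

lemma diagonal_mat_mult_vec_nth:
  fixes D :: "'a::comm_semiring_0 mat"
  assumes "D \<in> carrier_mat n n" "diagonal_mat D" "x \<in> carrier_vec n" "j < n"
  shows "vec_index (D *\<^sub>v x) j = D $$ (j, j) * vec_index x j"
proof -
  have "vec_index (D *\<^sub>v x) j = (\<Sum>i\<in>{0..<n}. D $$ (j, i) * vec_index x i)"
    using assms by (auto simp: scalar_prod_def)
  also have "\<dots> = (\<Sum>i\<in>{0..<n}. if i = j then D $$ (j, j) * vec_index x j else 0)"
    using assms by (intro sum.cong) (auto simp: diagonal_mat_def)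
  finally show ?thesis using assms(4) by simp
qed

text \<open>The \<open>j\<close>-th unit vector is an eigenvector. A hypothesis on the spectrum of
  \<open>D\<close> thus becomes one on its diagonal entries.\<close>

lemma diagonal_mat_diag_mem_spectrum:
  fixes D :: "'a::field mat"
  assumes "D \<in> carrier_mat n n" "diagonal_mat D" "j < n"
  shows "D $$ (j, j) \<in> spectrum D"
proof -
  have "D *\<^sub>v unit_vec n j = D $$ (j, j) \<cdot>\<^sub>v unit_vec n j"
  proof (rule eq_vecI)
    fix i assume "i < dim_vec (D $$ (j, j) \<cdot>\<^sub>v unit_vec n j)"
    then have i: "i < n" by simp
    show "vec_index (D *\<^sub>v unit_vec n j) i = vec_index (D $$ (j, j) \<cdot>\<^sub>v unit_vec n j) i"
      using i assms(3) by (subst diagonal_mat_mult_vec_nth[OF assms(1,2) _ i]) auto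
  qed (use assms in auto)
  then have "eigenvector D (unit_vec n j) (D $$ (j, j))"
    using assms unfolding eigenvector_def by auto
  then show ?thesis
    unfolding spectrum_def eigenvalue_def by auto
qed

lemma mat_diag_mult_vec_nth:
  fixes f :: "nat \<Rightarrow> 'a::comm_semiring_0"
  assumes "x \<in> carrier_vec n" "j < n"
  shows "vec_index (mat_diag n f *\<^sub>v x) j = f j * vec_index x j"
proof -
  have "diagonal_mat (mat_diag n f)"
    by (simp add: diagonal_mat_def mat_diag_def)
  then have "vec_index (mat_diag n f *\<^sub>v x) j = mat_diag n f $$ (j, j) * vec_index x j"
    by (intro diagonal_mat_mult_vec_nth[OF mat_diag_dim _ assms])
  then show ?thesis using assms(2) by (simp add: mat_diag_def)
qed

lemma of_coords_nth:
  fixes e :: "nat \<Rightarrow> 'n::finite"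
  assumes "bij_betw e {..<CARD('n)} UNIV" "k < CARD('n)"
  shows "of_coords e y $ e k = vec_index y k"
  using bij_betw_inv_into_left[OF assms(1)] assms(2) by (simp add: of_coords_def)

section \<open>The coordinates of \<open>psi\<close>, block by block\<close>

context
  fixes e :: "nat \<Rightarrow> 'n::finite" and p q r :: nat and a :: "complex Matrix.vec"
    and D :: "complex mat" and l :: "nat \<Rightarrow> complex" and lam :: real and b :: complex
  assumes e: "bij_betw e {..<CARD('n)} UNIV" and N: "1 + p + q + r = CARD('n)"
    and a: "a \<in> carrier_vec r" and D: "D \<in> carrier_mat q q" "diagonal_mat D"
begin

lemma psi_nth:
  assumes "k < CARD('n)"
  shows "psi e p q r lam a b D (mat_diag r l) x $ e k = vec_index
    (vCons (of_real lam * x $ e 0 + 2 * \<i> * (Matrix.vec r (\<lambda>j. x $ e (1 + p + q + j)) \<bullet>c a) + b)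
      ((of_real (sqrt lam) \<cdot>\<^sub>v Matrix.vec p (\<lambda>j. x $ e (1 + j))) @\<^sub>v
       (of_real (sqrt lam) \<cdot>\<^sub>v (D *\<^sub>v Matrix.vec q (\<lambda>j. x $ e (1 + p + j)))) @\<^sub>v
       (of_real (sqrt lam) \<cdot>\<^sub>v (mat_diag r l *\<^sub>v Matrix.vec r (\<lambda>j. x $ e (1 + p + q + j)))))) k"
  unfolding psi_def Let_def by (rule of_coords_nth[OF e assms])

lemma dim_mat_diag: "dim_row (mat_diag r l) = r"
  using mat_diag_dim[of r l] by blast

lemma psi_nth_first:
  "psi e p q r lam a b D (mat_diag r l) x $ e 0 = of_real lam * x $ e 0
     + 2 * \<i> * (\<Sum>j<r. x $ e (1 + p + q + j) * cnj (vec_index a j)) + b"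
proof -
  have "Matrix.vec r f \<bullet>c a = (\<Sum>j<r. f j * cnj (vec_index a j))" for f
    unfolding scalar_prod_def using a by (intro sum.cong) auto
  then show ?thesis
    by (subst psi_nth) simp_all
qed

lemma psi_nth_u:
  assumes "j < p"
  shows "psi e p q r lam a b D (mat_diag r l) x $ e (1 + j) = of_real (sqrt lam) * x $ e (1 + j)"
proof -
  have "1 + j < CARD('n)" using assms N by linarith
  then show ?thesis
    using assms by (simp only: psi_nth) (simp add: vec_index_vCons)
qed

lemma psi_nth_v:
  assumes "j < q"
  shows "psi e p q r lam a b D (mat_diag r l) x $ e (1 + p + j)
    = of_real (sqrt lam) * (D $$ (j, j) * x $ e (1 + p + j))"
proof -
  have "1 + p + j < CARD('n)" using assms N by linarith
  moreover have "vec_index (D *\<^sub>v Matrix.vec q f) j = D $$ (j, j) * f j" for f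
    using diagonal_mat_mult_vec_nth[OF D, of "Matrix.vec q f" j] assms by simp
  moreover have "dim_row D = q" using D by blast
  ultimately show ?thesis
    using assms by (simp only: psi_nth) (simp add: vec_index_vCons del: index_mult_mat_vec)
qed

lemma psi_nth_w:
  assumes "j < r"
  shows "psi e p q r lam a b D (mat_diag r l) x $ e (1 + p + q + j)
    = of_real (sqrt lam) * (l j * x $ e (1 + p + q + j))"
proof -
  have "1 + p + q + j < CARD('n)" using assms N by linarith
  moreover have "vec_index (mat_diag r l *\<^sub>v Matrix.vec r f) j = l j * f j" for f
    using mat_diag_mult_vec_nth[of "Matrix.vec r f" r j l] assms by simp
  moreover have "dim_row D = q" using D by blast
  ultimately show ?thesis
    using assms by (simp only: psi_nth) (simp add: vec_index_vCons dim_mat_diag del: index_mult_mat_vec)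
qed

end

lemma Theta_quadratic_form:
  assumes "a \<in> carrier_vec r"
  shows "Re ((Theta r lam l u v *\<^sub>v a) \<bullet>c a) = (\<Sum>j<r. (lam - 1) / (2 * u j * ln lam) *
      (((ln lam / 2 + u j)\<^sup>2 + (v j)\<^sup>2) /
       (cmod (complex_of_real lam - complex_of_real (sqrt lam) * l j))\<^sup>2) * (cmod (vec_index a j))\<^sup>2)"
proof -
  have "(mat_diag r (\<lambda>j. complex_of_real (f j)) *\<^sub>v a) \<bullet>c a
      = (\<Sum>j<r. of_real (f j * (cmod (vec_index a j))\<^sup>2))" for f
    unfolding scalar_prod_def
  proof (rule sum.cong)
    fix j assume "j \<in> {..<r}"
    then have j: "j < r" by simp
    have "vec_index (conjugate a) j = cnj (vec_index a j)"
      using assms j by simp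
    then show "vec_index (mat_diag r (\<lambda>j. complex_of_real (f j)) *\<^sub>v a) j * vec_index (conjugate a) j
        = of_real (f j * (cmod (vec_index a j))\<^sup>2)"
      unfolding mat_diag_mult_vec_nth[OF assms j]
      by (simp only: of_real_mult complex_norm_square mult.assoc)
  qed (use assms in auto)
  then show ?thesis
    unfolding Theta_def by (simp only: Re_sum Re_complex_of_real)
qed

text \<open>Since \<open>Re (\<gamma> * \<zeta>)\<close> is at least minus the product of the
  moduli, the expression is bounded below by a square over \<open>2 * u\<close>. The constant
  \<open>(cmod \<gamma>)\<^sup>2 / (2 * u)\<close> is the least possible: equality holds at
  \<open>\<zeta> = - cnj \<gamma> / (2 * u)\<close>.\<close>

lemma complete_square_nonneg:
  assumes "u > 0"
  shows "0 \<le> (cmod \<gamma>)\<^sup>2 / (2 * u) + 2 * Re (\<gamma> * \<zeta>) + 2 * u * (cmod \<zeta>)\<^sup>2"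
proof -
  have "- (cmod \<gamma> * cmod \<zeta>) \<le> Re (\<gamma> * \<zeta>)"
    using abs_Re_le_cmod[of "\<gamma> * \<zeta>"] by (simp add: norm_mult)
  moreover have "0 \<le> (cmod \<gamma> - 2 * u * cmod \<zeta>)\<^sup>2 / (2 * u)"
    using assms by simp
  moreover have "(cmod \<gamma> - 2 * u * cmod \<zeta>)\<^sup>2 / (2 * u)
      = (cmod \<gamma>)\<^sup>2 / (2 * u) - 2 * (cmod \<gamma> * cmod \<zeta>) + 2 * u * (cmod \<zeta>)\<^sup>2"
    using assms by (simp add: field_simps power2_eq_square)
  ultimately show ?thesis by linarith
qed

theorem theorem1p9:
  fixes \<phi> :: "complex ^ 'n \<Rightarrow> complex ^ 'n"
    and e :: "nat \<Rightarrow> 'n" and p q r :: nat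
    and lam :: real and a :: "complex Matrix.vec" and b :: complex
    and D :: "complex mat" and l :: "nat \<Rightarrow> complex" and u v :: "nat \<Rightarrow> real"
  assumes "bij_betw e {..<CARD('n)} UNIV"
    and "1 + p + q + r = CARD('n)"
    and "\<phi> \<in> LFM" and "hyperbolic \<phi>"
    and "conjugated \<phi> (ball 0 1) (psi e p q r lam a b D (mat_diag r l)) (siegel e)"
    and "lam > 1"
    and "a \<in> carrier_vec r"
    and "D \<in> carrier_mat q q" and "diagonal_mat D" and "spectrum D \<subseteq> sphere 0 1 - {1}"
    and "\<And>j. j < r \<Longrightarrow> 0 < cmod (l j) \<and> cmod (l j) < 1"
    and "\<And>j. j < r \<Longrightarrow> l j = exp (- complex_of_real (u j) + \<i> * complex_of_real (v j))"
    and "\<And>j. j < r \<Longrightarrow> u j > 0"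
    and "\<And>j. j < r \<Longrightarrow> v j \<in> {0..<2 * pi}"
    and "Im b \<ge> Re ((Theta r lam l u v *\<^sub>v a) \<bullet>c a)"
  shows "embeddable \<phi> (ball 0 1)"
proof -
  note e = assms(1) and N = assms(2) and lam = assms(6) and a = assms(7) and D = assms(8,9)
    and u = assms(13)

  \<comment> \<open>Positions and blocks of coordinates\<close>
  define \<iota> where "\<iota> = inv_into {..<CARD('n)} e"
  have \<iota>_e: "\<iota> (e k) = k" if "k < CARD('n)" for k
    using bij_betw_inv_into_left[OF e] that by (simp add: \<iota>_def)
  have e_first: "e k = e 0 \<longleftrightarrow> k = 0" if "k < CARD('n)" for k
    using \<iota>_e[OF that] \<iota>_e[of 0] by force
  have bounds: "j < p \<Longrightarrow> 1 + j < CARD('n)" "j < q \<Longrightarrow> 1 + p + j < CARD('n)"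
    "j < r \<Longrightarrow> 1 + p + q + j < CARD('n)" "k < 1 + p + q \<Longrightarrow> k < CARD('n)"
    "k < CARD('n) \<Longrightarrow> \<not> k < 1 + p + q \<Longrightarrow> k - (1 + p + q) < r" for j k
    using N by linarith+
  have coord_cases: "P i" if "P (e 0)" and "\<And>j. j < p \<Longrightarrow> P (e (1 + j))"
    and "\<And>j. j < q \<Longrightarrow> P (e (1 + p + j))" and "\<And>j. j < r \<Longrightarrow> P (e (1 + p + q + j))" for P i
  proof -
    have "\<exists>k<CARD('n). i = e k"
      using bij_betw_inv_into_right[OF e, of i] bij_betw_apply[OF bij_betw_inv_into[OF e], of i]
      by (intro exI[of _ "\<iota> i"]) (simp add: \<iota>_def)
    then obtain k where k: "k < CARD('n)" "i = e k" by blast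
    consider "k = 0" | "1 \<le> k" "k < 1 + p" | "1 + p \<le> k" "k < 1 + p + q" | "1 + p + q \<le> k" "k < 1 + p + q + r"
      using k N by linarith
    then show ?thesis
    proof cases
      case 1
      then show ?thesis using that(1) k by simp
    next
      case 2
      then show ?thesis using that(2)[of "k - 1"] k by simp
    next
      case 3
      then show ?thesis using that(3)[of "k - (1 + p)"] k by simp
    next
      case 4
      then show ?thesis using that(4)[of "k - (1 + p + q)"] k by simp
    qed
  qed

  \<comment> \<open>Generator of the flow\<close>
  define L where "L = ln lam"
  have L: "L > 0" using lam by (simp add: L_def)
  have exp_L: "exp (complex_of_real L) = of_real lam"
    using lam by (simp add: L_def exp_of_real)
  have exp_half: "exp (complex_of_real (L / 2)) = of_real (sqrt lam)"
  proof -
    have "L / 2 = ln (sqrt lam)"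
      using lam ln_sqrt[of lam] by (simp only: L_def)
    then have "exp (L / 2) = sqrt lam"
      using lam by (simp only: exp_ln real_sqrt_gt_zero)
    then show ?thesis by (simp only: exp_of_real)
  qed

  \<comment> \<open>The modulus of \<open>sqrt lam * l j\<close> is below \<open>sqrt lam\<close>,
    which is at most \<open>lam\<close>.\<close>
  have ne: "complex_of_real lam - of_real (sqrt lam) * l j \<noteq> 0" if "j < r" for j
  proof
    assume "complex_of_real lam - of_real (sqrt lam) * l j = 0"
    then have "cmod (complex_of_real lam) = cmod (of_real (sqrt lam) * l j)" by simp
    then have "lam = sqrt lam * cmod (l j)"
      using lam by (simp add: norm_mult)
    also have "\<dots> < sqrt lam * 1"
      using assms(11)[OF that] lam by (intro mult_strict_left_mono) auto
    also have "\<dots> \<le> lam"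
      using lam real_le_lsqrt[of lam lam] by (simp add: power2_eq_square)
    finally show False by simp
  qed

  \<comment> \<open>Logarithms of the multipliers \<open>sqrt lam\<close>,
    \<open>sqrt lam * D $$ (j, j)\<close> and \<open>sqrt lam * l j\<close>. In the last block the
    branch is the one given by \<open>u\<close> and \<open>v\<close>, since \<open>v j\<close>
    enters \<open>Theta\<close>.\<close>
  define M where "M k = (if k < 1 + p then complex_of_real (L / 2)
    else if k < 1 + p + q then of_real (L / 2) + \<i> * of_real (Arg (D $$ (k - (1 + p), k - (1 + p))))
    else of_real (L / 2) + (- of_real (u (k - (1 + p + q))) + \<i> * of_real (v (k - (1 + p + q)))))" for k
  \<comment> \<open>Solved from the requirement that \<open>coupling 1\<close> be
    \<open>cnj (vec_index a j)\<close> in the last block and zero in the other two.\<close>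
  define G where "G k = (if k < 1 + p + q then 0 else cnj (vec_index a (k - (1 + p + q))) *
      (of_real L - M k) / (of_real lam - of_real (sqrt lam) * l (k - (1 + p + q))))" for k
  \<comment> \<open>The constant of \<open>complete_square_nonneg\<close>. In the first two blocks
    both \<open>G k\<close> and \<open>L - 2 * Re (M k)\<close> vanish, so zero suffices.\<close>
  define K where "K k = (if k < 1 + p + q then 0 else (cmod (G k))\<^sup>2 / (2 * u (k - (1 + p + q))))" for k
  \<comment> \<open>Solved from \<open>drift 1 = b\<close>, as \<open>drift 1\<close> is
    \<open>\<beta> * (lam - 1) / L\<close>.\<close>
  define \<beta> where "\<beta> = b * of_real (L / (lam - 1))"

  have Re_M: "L - 2 * Re (M k) = (if k < 1 + p + q then 0 else 2 * u (k - (1 + p + q)))" for k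
    by (simp add: M_def)
  \<comment> \<open>The real parts differ: equality would make \<open>L - 2 * Re (M k)\<close> equal
    to \<open>- L < 0\<close>, whereas it is zero or \<open>2 * u j > 0\<close>.\<close>
  have L_ne_M: "complex_of_real L \<noteq> M k" if "k < CARD('n)" for k
  proof
    assume "complex_of_real L = M k"
    then have "Re (M k) = L" using Re_complex_of_real[of L] by (simp only:)
    then show False
      using Re_M[of k] u[OF bounds(5)[OF that]] L by (cases "k < 1 + p + q") simp_all
  qed

  have sum_coords: "(\<Sum>i\<in>UNIV - {e 0}. f i) = (\<Sum>j<r. f (e (1 + p + q + j)))"
    if "\<And>k. k < 1 + p + q \<Longrightarrow> f (e k) = 0" for f :: "'n \<Rightarrow> 'c::comm_monoid_add"
  proof -
    have "(\<Sum>i\<in>UNIV - {e 0}. f i) = (\<Sum>k = 1..<CARD('n). f (e k))"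
      by (rule sum_except_first_coord[OF e])
    also have "\<dots> = (\<Sum>k = 1 + p + q..<1 + p + q + r. f (e k))"
      using that N by (intro sum.mono_neutral_right) auto
    also have "\<dots> = (\<Sum>j<r. f (e (1 + p + q + j)))"
      by (rule sum.reindex_bij_witness[of _ "\<lambda>j. 1 + p + q + j" "\<lambda>k. k - (1 + p + q)"]) auto
    finally show ?thesis .
  qed

  \<comment> \<open>This is where the entries of \<open>Theta\<close> come from:
    \<open>L - M k\<close> is \<open>L / 2 + u j - \<i> * v j\<close>, whose squared modulus is the
    numerator in \<open>Theta\<close>.\<close>
  have K_eq: "K (1 + p + q + j) = L / (lam - 1) * ((lam - 1) / (2 * u j * ln lam) *
      (((ln lam / 2 + u j)\<^sup>2 + (v j)\<^sup>2) /
       (cmod (complex_of_real lam - complex_of_real (sqrt lam) * l j))\<^sup>2) * (cmod (vec_index a j))\<^sup>2)"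
    if "j < r" for j
  proof -
    have "(cmod (of_real L - M (1 + p + q + j)))\<^sup>2 = (L / 2 + u j)\<^sup>2 + (v j)\<^sup>2"
      by (simp add: M_def cmod_power2)
    then have "K (1 + p + q + j) = (cmod (vec_index a j))\<^sup>2 * ((L / 2 + u j)\<^sup>2 + (v j)\<^sup>2) /
        (cmod (complex_of_real lam - of_real (sqrt lam) * l j))\<^sup>2 / (2 * u j)"
      by (simp add: K_def G_def norm_mult norm_divide power_mult_distrib power_divide)
    moreover have "x * y / z / (2 * w) = L / (lam - 1) * ((lam - 1) / (2 * w * L) * (y / z) * x)"
      for x y z w :: real
      using L lam by (simp add: ac_simps)
    ultimately show ?thesis
      unfolding L_def[symmetric] by (simp only:)
  qed

  interpret siegel_flow L "\<lambda>i. M (\<iota> i)" "\<lambda>i. G (\<iota> i)" \<beta> "e 0" "\<lambda>i. K (\<iota> i)"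
  proof
    show "L > 0" by fact
    show "complex_of_real L \<noteq> M (\<iota> i)" for i
      using L_ne_M bij_betw_apply[OF bij_betw_inv_into[OF e], of i] by (simp add: \<iota>_def)
    show "0 \<le> K (\<iota> i) + 2 * Re (G (\<iota> i) * \<zeta>) + (L - 2 * Re (M (\<iota> i))) * (cmod \<zeta>)\<^sup>2" for i \<zeta>
    proof -
      have i: "\<iota> i < CARD('n)"
        using bij_betw_apply[OF bij_betw_inv_into[OF e], of i] by (simp add: \<iota>_def)
      show ?thesis
      proof (cases "\<iota> i < 1 + p + q")
        case True
        then show ?thesis by (simp add: Re_M K_def G_def)
      next
        case False
        then show ?thesis
          using complete_square_nonneg[OF u[OF bounds(5)[OF i False]], of "G (\<iota> i)" \<zeta>]
          by (simp only: Re_M K_def if_False)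
      qed
    qed
    \<comment> \<open>Scaled by \<open>L / (lam - 1)\<close>, the hypothesis on \<open>Im b\<close>
      is exactly the bound on the sum of the constants \<open>K\<close>.\<close>
    have "(\<Sum>i\<in>UNIV - {e 0}. K (\<iota> i)) = (\<Sum>j<r. K (1 + p + q + j))"
      by (subst sum_coords) (simp_all add: \<iota>_e bounds K_def del: One_nat_def)
    also have "\<dots> = L / (lam - 1) * Re ((Theta r lam l u v *\<^sub>v a) \<bullet>c a)"
      unfolding Theta_quadratic_form[OF a] sum_distrib_left using K_eq by (intro sum.cong) auto
    also have "\<dots> \<le> L / (lam - 1) * Im b"
      using assms(15) L lam by (intro mult_left_mono) auto
    also have "\<dots> = Im \<beta>" by (simp add: \<beta>_def)
    finally show "(\<Sum>i\<in>UNIV - {e 0}. K (\<iota> i)) \<le> Im \<beta>" .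
  qed

  have exp_M_w: "exp (M (1 + p + q + j)) = of_real (sqrt lam) * l j" if "j < r" for j
  proof -
    have "M (1 + p + q + j) = of_real (L / 2) + (- of_real (u j) + \<i> * of_real (v j))"
      by (simp add: M_def)
    then show ?thesis
      using exp_half assms(12)[OF that] by (simp only: exp_add)
  qed

  \<comment> \<open>The time-one map\<close>
  have "flow 1 x = psi e p q r lam a b D (mat_diag r l) x" for x
    unfolding Finite_Cartesian_Product.vec_eq_iff
  proof
    fix i
    show "flow 1 x $ i = psi e p q r lam a b D (mat_diag r l) x $ i"
    proof (induction i rule: coord_cases)
      case 1
      have c: "coupling 1 (e (1 + p + q + j)) = cnj (vec_index a j)" if "j < r" for j
      proof -
        note k = bounds(3)[OF that]
        \<comment> \<open>The factors \<open>lam - sqrt lam * l j\<close> and \<open>L - M k\<close>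
          introduced by \<open>G\<close> cancel, both being nonzero.\<close>
        have "coupling 1 (e (1 + p + q + j)) = cnj (vec_index a j) * (of_real L - M (1 + p + q + j)) /
            (of_real lam - of_real (sqrt lam) * l j) * (of_real lam - of_real (sqrt lam) * l j)
            / (of_real L - M (1 + p + q + j))"
          unfolding coupling_def \<iota>_e[OF k] using exp_M_w[OF that] by (simp add: G_def exp_L)
        then show ?thesis
          using L_ne_M[OF k] ne[OF that] by simp
      qed
      have coupling_G: "coupling 1 (e k) = 0" if "k < 1 + p + q" for k
        unfolding coupling_def using \<iota>_e[OF bounds(4)[OF that]] that by (simp add: G_def)
      have d: "drift 1 = b"
        unfolding drift_def using L lam by (simp add: \<beta>_def exp_L)
      have "(\<Sum>i\<in>UNIV - {e 0}. coupling 1 i * x $ i)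
          = (\<Sum>j<r. coupling 1 (e (1 + p + q + j)) * x $ e (1 + p + q + j))"
        by (rule sum_coords) (simp add: coupling_G)
      also have "\<dots> = (\<Sum>j<r. x $ e (1 + p + q + j) * cnj (vec_index a j))"
        using c by (intro sum.cong) (simp_all add: mult.commute)
      finally have "(\<Sum>i\<in>UNIV - {e 0}. coupling 1 i * x $ i)
          = (\<Sum>j<r. x $ e (1 + p + q + j) * cnj (vec_index a j))" .
      then show ?case
        by (simp add: flow_nth_first psi_nth_first[OF e N a D] exp_L d)
    next
      case (2 j)
      have "exp (M (1 + j)) = of_real (sqrt lam)" using 2 exp_half by (simp add: M_def)
      then show ?case
        unfolding psi_nth_u[OF e N a D 2] using e_first[OF bounds(1)[OF 2]] \<iota>_e[OF bounds(1)[OF 2]]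
        by (simp add: flow_nth_other)
    next
      case (3 j)
      \<comment> \<open>The spectrum lies on the unit circle, so each diagonal entry is the
        exponential of \<open>\<i>\<close> times its argument.\<close>
      have "cmod (D $$ (j, j)) = 1"
        using diagonal_mat_diag_mem_spectrum[OF D 3] assms(10) by auto
      then have "exp (\<i> * of_real (Arg (D $$ (j, j)))) = D $$ (j, j)"
        using Arg_eq[of "D $$ (j, j)"] by force
      moreover have "M (1 + p + j) = of_real (L / 2) + \<i> * of_real (Arg (D $$ (j, j)))"
        using 3 by (simp add: M_def)
      ultimately have "exp (M (1 + p + j)) = of_real (sqrt lam) * D $$ (j, j)"
        using exp_half by (simp only: exp_add)
      then show ?case
        unfolding psi_nth_v[OF e N a D 3] using e_first[OF bounds(2)[OF 3]] \<iota>_e[OF bounds(2)[OF 3]]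
        by (simp add: flow_nth_other)
    next
      case (4 j)
      then show ?case
        unfolding psi_nth_w[OF e N a D 4] using e_first[OF bounds(3)[OF 4]] \<iota>_e[OF bounds(3)[OF 4]] exp_M_w[OF 4]
        by (simp add: flow_nth_other)
    qed
  qed
  then have "embeddable (psi e p q r lam a b D (mat_diag r l)) (siegel e)"
    unfolding embeddable_def siegel_eq[OF e] using holo_semigroup_flow by auto
  then show ?thesis
    using embeddable_if_conjugated[OF assms(5) open_siegel[OF e]] by blast
qed

end
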